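(* Let $A\subset\mathbb{R}$ be an unbounded subset, let $A'$ be a metric space with $d_{GH}(A,A')<\infty$, let $B\subset\mathbb{R}$ be an arbitrary subset, and let $X$ and $Y$ be bounded metric spaces. Then $$d_{GH}\bigl(A'\times_{\ell^1}X,\;B\times_{\ell^1}Y\bigr)\ \ge\ \frac{\operatorname{diam}X-\operatorname{diam}Y}{2}.$$
   Context: All metric spaces are non-empty. Subsets of $\mathbb{R}$ carry the metric $|x-y|$ induced from $\mathbb{R}$. For metric spaces $X,Y$, $d_{GH}(X,Y)\in[0,\infty]$ is the Gromov--Hausdorff distance: the infimum of the numbers $r\ge 0$ such that there exist a metric space $Z$ and subsets $X',Y'\subset Z$ isometric to $X$ and $Y$ respectively with Hausdorff distance $d_H(X',Y')\le r$ (it may be infinite). Equivalently, $2d_{GH}(X,Y)=\inf\{\operatorname{dis}R\}$ over all correspondences $R\subset X\times Y$ (subsets projecting onto both factors), where $\operatorname{dis}R=\sup\{\,||xx'|-|yy'||:(x,y),(x',y')\in R\}$. For metric spaces $(X,d_X)$, $(Y,d_Y)$, $X\times_{\ell^1}Y$ denotes the Cartesian product with the metric $d((x,y),(x',y'))=d_X(x,x')+d_Y(y,y')$. $\operatorname{diam}X=\sup\{d_X(x,x'):x,x'\in X\}$. *)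

theory Defs
  imports "HOL-Analysis.Analysis"
begin

text \<open>
  Metric spaces are values of the library type \<open>'a metric\<close>, whose carrier may be empty;
  non-emptiness is therefore an explicit assumption wherever it is needed.
\<close>

definition isometric :: "'a metric \<Rightarrow> 'b metric \<Rightarrow> bool" where
  "isometric X Y \<longleftrightarrow>
     (\<exists>f. bij_betw f (mspace X) (mspace Y) \<and>
          (\<forall>x\<in>mspace X. \<forall>x'\<in>mspace X. mdist Y (f x) (f x') = mdist X x x'))"

definition hausdorff_dist :: "'a metric \<Rightarrow> 'a set \<Rightarrow> 'a set \<Rightarrow> ereal" where
  "hausdorff_dist Z S T =
     max (SUP x\<in>S. INF y\<in>T. ereal (mdist Z x y)) (SUP y\<in>T. INF x\<in>S. ereal (mdist Z x y))"

text \<open>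
  The type of the ambient space has to be fixed. The sum type loses no generality, since
  \<open>X' \<union> Y'\<close> always embeds into it: see \<open>gh_dist_le_any_type\<close> below.
\<close>

definition gh_dist :: "'a metric \<Rightarrow> 'b metric \<Rightarrow> ereal" where
  "gh_dist X Y =
     Inf {ereal r | r. 0 \<le> r \<and>
       (\<exists>(Z :: ('a + 'b) metric) X' Y'.
          X' \<subseteq> mspace Z \<and> Y' \<subseteq> mspace Z \<and>
          isometric X (submetric Z X') \<and> isometric Y (submetric Z Y') \<and>
          hausdorff_dist Z X' Y' \<le> ereal r)}"

definition metric_diam :: "'a metric \<Rightarrow> ereal" where
  "metric_diam X = (SUP (x, x')\<in>mspace X \<times> mspace X. ereal (mdist X x x'))"

definition bounded_metric :: "'a metric \<Rightarrow> bool" where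
  "bounded_metric X \<longleftrightarrow> Metric_space.mbounded (mspace X) (mdist X) (mspace X)"

text \<open>The library's \<^const>\<open>prod_metric\<close> is the \<open>\<ell>\<close>-2 product, so it cannot be used here.\<close>

definition l1_prod :: "'a metric \<Rightarrow> 'b metric \<Rightarrow> ('a \<times> 'b) metric" where
  "l1_prod X Y =
     metric (mspace X \<times> mspace Y, \<lambda>(x, y) (x', y'). mdist X x x' + mdist Y y y')"

lemma Metric_space_l1_prod:
  "Metric_space (mspace X \<times> mspace Y) (\<lambda>(x, y) (x', y'). mdist X x x' + mdist Y y y')"
proof -
  interpret X: Metric_space "mspace X" "mdist X" by simp
  interpret Y: Metric_space "mspace Y" "mdist Y" by simp
  show ?thesis
  proof (unfold_locales, goal_cases)
    case (1 x y)
    then show ?case by (auto split: prod.split)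
  next
    case (2 x y)
    then show ?case by (auto simp: X.commute Y.commute split: prod.split)
  next
    case (3 x y)
    then show ?case by (auto simp: add_nonneg_eq_0_iff split: prod.split)
  next
    case (4 x y z)
    then show ?case
      using X.triangle[of "fst x" "fst y" "fst z"] Y.triangle[of "snd x" "snd y" "snd z"]
      by (auto split: prod.split)
  qed
qed

lemma mspace_l1_prod [simp]: "mspace (l1_prod X Y) = mspace X \<times> mspace Y"
  by (simp add: l1_prod_def Metric_space.mspace_metric[OF Metric_space_l1_prod])

lemma mdist_l1_prod [simp]:
  "mdist (l1_prod X Y) (x, y) (x', y') = mdist X x x' + mdist Y y y'"
  by (simp add: l1_prod_def Metric_space.mdist_metric[OF Metric_space_l1_prod])

lemma gh_dist_le_any_type:
  fixes X :: "'a metric" and Y :: "'b metric" and Z :: "'c metric"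
  assumes r: "0 \<le> r" and X': "X' \<subseteq> mspace Z" and Y': "Y' \<subseteq> mspace Z"
    and isoX: "isometric X (submetric Z X')" and isoY: "isometric Y (submetric Z Y')"
    and H: "hausdorff_dist Z X' Y' \<le> ereal r"
  shows "gh_dist X Y \<le> ereal r"
proof -
  have [simp]: "X' \<inter> mspace Z = X'" "Y' \<inter> mspace Z = Y'" using X' Y' by auto
  obtain f where f: "bij_betw f (mspace X) X'"
    and fd: "\<And>x x'. x \<in> mspace X \<Longrightarrow> x' \<in> mspace X \<Longrightarrow> mdist Z (f x) (f x') = mdist X x x'"
    using isoX unfolding isometric_def by auto
  obtain g where g: "bij_betw g (mspace Y) Y'"
    and gd: "\<And>x x'. x \<in> mspace Y \<Longrightarrow> x' \<in> mspace Y \<Longrightarrow> mdist Z (g x) (g x') = mdist Y x x'"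
    using isoY unfolding isometric_def by auto
  define e where "e = (\<lambda>z. if z \<in> X' then Inl (inv_into (mspace X) f z)
                           else Inr (inv_into (mspace Y) g z) :: 'a + 'b)"
  define U where "U = X' \<union> Y'"
  have e: "inj_on e U"
    unfolding inj_on_def
  proof (intro ballI impI)
    fix z z' assume z: "z \<in> U" "z' \<in> U" and eq: "e z = e z'"
    have "inj_on (inv_into (mspace X) f) X'" "inj_on (inv_into (mspace Y) g) Y'"
      using f g by (auto simp: bij_betw_def intro: inj_on_inv_into)
    then show "z = z'"
      using z eq unfolding e_def U_def by (auto split: if_splits dest: inj_onD)
  qed
  define h where "h = inv_into U e"
  have he: "h (e z) = z" if "z \<in> U" for z
    using that e by (simp add: h_def)
  define W where "W = metric (e ` U, \<lambda>p q. mdist Z (h p) (h q))"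
  interpret Z: Metric_space "mspace Z" "mdist Z" by simp
  have UZ: "U \<subseteq> mspace Z" using X' Y' by (auto simp: U_def)
  have W: "Metric_space (e ` U) (\<lambda>p q. mdist Z (h p) (h q))"
  proof (unfold_locales, goal_cases)
    case (3 x y)
    then show ?case using UZ he by (auto simp: subset_iff)
  next
    case (4 x y z)
    then show ?case using UZ he by (auto simp: subset_iff intro!: Z.triangle)
  qed (auto simp: Z.commute)
  have mW [simp]: "mspace W = e ` U" "mdist W = (\<lambda>p q. mdist Z (h p) (h q))"
    using W by (simp_all add: W_def Metric_space.mspace_metric Metric_space.mdist_metric)
  have XU: "X' \<subseteq> U" "Y' \<subseteq> U" by (auto simp: U_def)
  have eX: "e ` X' \<inter> e ` U = e ` X'" "e ` Y' \<inter> e ` U = e ` Y'" using XU by auto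
  have "bij_betw e X' (e ` X')" "bij_betw e Y' (e ` Y')"
    using e XU by (auto simp: bij_betw_def intro: inj_on_subset)
  then have bij: "bij_betw (e \<circ> f) (mspace X) (e ` X')" "bij_betw (e \<circ> g) (mspace Y) (e ` Y')"
    using f g by (auto intro: bij_betw_trans)
  have fU: "f x \<in> U" if "x \<in> mspace X" for x using f that XU by (auto simp: bij_betw_def)
  have gU: "g x \<in> U" if "x \<in> mspace Y" for x using g that XU by (auto simp: bij_betw_def)
  have "isometric X (submetric W (e ` X'))"
    unfolding isometric_def using bij(1) fd fU he by (intro exI[of _ "e \<circ> f"]) (auto simp: eX)
  moreover have "isometric Y (submetric W (e ` Y'))"
    unfolding isometric_def using bij(2) gd gU he by (intro exI[of _ "e \<circ> g"]) (auto simp: eX)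
  moreover have "hausdorff_dist W (e ` X') (e ` Y') = hausdorff_dist Z X' Y'"
  proof -
    have hX: "h (e z) = z" if "z \<in> X'" for z using he that XU by auto
    have hY: "h (e z) = z" if "z \<in> Y'" for z using he that XU by auto
    show ?thesis
      unfolding hausdorff_dist_def mW image_image by (simp add: hX hY cong: image_cong_simp)
  qed
  moreover have "e ` X' \<subseteq> mspace W" "e ` Y' \<subseteq> mspace W" using XU by auto
  ultimately show ?thesis
    unfolding gh_dist_def using r H by (intro Inf_lower CollectI exI[of _ r]) metis
qed

end

theory Submission
  imports Defs
begin

text \<open>
  A bound \<open>d\<^sub>G\<^sub>H(P, Q) < r\<close> provides a map \<open>F : P \<rightarrow> Q\<close> that changes distances by at most \<open>2 r\<close>
  (\<open>gh_dist_less_imp_map\<close>). Applied to \<open>A\<close> and \<open>A'\<close>, it shows that \<open>A'\<close> is unbounded.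

  Let \<open>F : A' \<times> X \<rightarrow> B \<times> Y\<close> change distances by at most \<open>\<delta>\<close>, fix \<open>x, x' \<in> X\<close>, and
  let \<open>f a\<close> and \<open>g a\<close> be the \<open>B\<close>-coordinates of \<open>F (a, x)\<close> and \<open>F (a, x')\<close>. Dropping the
  \<open>Y\<close>-coordinate loses at most \<open>diam Y\<close>, so with \<open>\<kappa> = |x x'| - \<delta> - diam Y\<close> we have
  \<open>|f a - g b| \<ge> |a b| + \<kappa>\<close>, while \<open>|f a - f b|\<close> and \<open>|g a - g b|\<close> are at most \<open>|a b| + \<delta>\<close>.
  Since \<open>f\<close> is unbounded on \<open>A'\<close>, after a reflection of the line one can walk along points
  \<open>a\<^sub>0, a\<^sub>1, a\<^sub>2, \<dots>\<close> of \<open>A'\<close> for which \<open>f\<close> and \<open>g\<close> both move to the right in large steps. On each step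
  the sum \<open>f + g\<close> then grows by at least \<open>2 |a\<^sub>n a\<^sub>n\<^sub>+\<^sub>1| + 2 \<kappa>\<close>: the two lower bounds used are those
  for the crossed pairs \<open>f a\<^sub>n\<^sub>+\<^sub>1 - g a\<^sub>n\<close> and \<open>g a\<^sub>n\<^sub>+\<^sub>1 - f a\<^sub>n\<close>. By the triangle inequality it has grown
  by at least \<open>2 |a\<^sub>0 a\<^sub>n| + 2 n \<kappa>\<close> after \<open>n\<close> steps. It cannot have grown by more than
  \<open>2 |a\<^sub>0 a\<^sub>n| + 2 \<delta>\<close>, whence \<open>n \<kappa> \<le> \<delta>\<close> for all \<open>n\<close>, that is, \<open>\<kappa> \<le> 0\<close>. The supremum over
  \<open>x, x'\<close> and the infimum over \<open>\<delta>\<close> give the theorem.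
\<close>

text \<open>The map sends a point of \<open>X\<close> to a point of \<open>Y\<close> at distance less than \<open>r\<close> in the ambient space.\<close>

lemma gh_dist_less_imp_map:
  assumes "gh_dist X Y < ereal r"
  obtains F where "F \<in> mspace X \<rightarrow> mspace Y"
    and "\<And>p q. p \<in> mspace X \<Longrightarrow> q \<in> mspace X \<Longrightarrow> \<bar>mdist Y (F p) (F q) - mdist X p q\<bar> \<le> 2 * r"
proof -
  obtain s and Z :: "('a + 'b) metric" and X' Y' where "s < r"
    and sub: "X' \<subseteq> mspace Z" "Y' \<subseteq> mspace Z"
    and isoX: "isometric X (submetric Z X')" and isoY: "isometric Y (submetric Z Y')"
    and H: "hausdorff_dist Z X' Y' \<le> ereal s"
    using assms unfolding gh_dist_def Inf_less_iff by auto
  interpret Z: Metric_space "mspace Z" "mdist Z" by simp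
  have inter [simp]: "X' \<inter> mspace Z = X'" "Y' \<inter> mspace Z = Y'" using sub by auto
  obtain i where i: "bij_betw i (mspace X) X'"
    and id: "\<And>p q. p \<in> mspace X \<Longrightarrow> q \<in> mspace X \<Longrightarrow> mdist Z (i p) (i q) = mdist X p q"
    using isoX unfolding isometric_def by auto
  obtain j where j: "bij_betw j (mspace Y) Y'"
    and jd: "\<And>p q. p \<in> mspace Y \<Longrightarrow> q \<in> mspace Y \<Longrightarrow> mdist Z (j p) (j q) = mdist Y p q"
    using isoY unfolding isometric_def by auto
  have "\<exists>y\<in>mspace Y. mdist Z (i p) (j y) < r" if p: "p \<in> mspace X" for p
  proof -
    have "i p \<in> X'" using i p by (auto simp: bij_betw_def)
    then have "(INF z\<in>Y'. ereal (mdist Z (i p) z)) \<le> (SUP x\<in>X'. INF z\<in>Y'. ereal (mdist Z x z))"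
      by (rule SUP_upper)
    also have "\<dots> \<le> ereal s" using H by (simp add: hausdorff_dist_def)
    also have "\<dots> < ereal r" using \<open>s < r\<close> by simp
    finally show ?thesis using j by (auto simp: INF_less_iff bij_betw_def)
  qed
  then obtain F where F: "\<And>p. p \<in> mspace X \<Longrightarrow> F p \<in> mspace Y"
    and Fd: "\<And>p. p \<in> mspace X \<Longrightarrow> mdist Z (i p) (j (F p)) < r"
    by metis
  show thesis
  proof
    show "F \<in> mspace X \<rightarrow> mspace Y" using F by auto
  next
    fix p q assume p: "p \<in> mspace X" and q: "q \<in> mspace X"
    have ij: "i p \<in> mspace Z" "i q \<in> mspace Z" "j (F p) \<in> mspace Z" "j (F q) \<in> mspace Z"
      using p q F i j sub by (auto simp: bij_betw_def)
    have "mdist Z (i p) (i q) \<le> mdist Z (i p) (j (F p)) + mdist Z (j (F p)) (j (F q))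
             + mdist Z (i q) (j (F q))"
      using Z.triangle[of "i p" "j (F p)" "i q"] Z.triangle[of "j (F p)" "j (F q)" "i q"] ij
      by (simp add: Z.commute)
    moreover have "mdist Z (j (F p)) (j (F q)) \<le> mdist Z (i p) (j (F p)) + mdist Z (i p) (i q)
             + mdist Z (i q) (j (F q))"
      using Z.triangle[of "j (F p)" "i p" "j (F q)"] Z.triangle[of "i p" "i q" "j (F q)"] ij
      by (simp add: Z.commute)
    ultimately show "\<bar>mdist Y (F p) (F q) - mdist X p q\<bar> \<le> 2 * r"
      using Fd[OF p] Fd[OF q] id[OF p q] jd[OF F[OF p] F[OF q]] by linarith
  qed
qed

lemma bounded_metric_diam:
  assumes "bounded_metric Y" and "mspace Y \<noteq> {}"
  obtains m where "metric_diam Y = ereal m"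
    and "\<And>y y'. y \<in> mspace Y \<Longrightarrow> y' \<in> mspace Y \<Longrightarrow> mdist Y y y' \<le> m"
proof -
  interpret Y: Metric_space "mspace Y" "mdist Y" by simp
  obtain C where C: "\<And>y y'. y \<in> mspace Y \<Longrightarrow> y' \<in> mspace Y \<Longrightarrow> mdist Y y y' \<le> C"
    using assms(1) unfolding bounded_metric_def Y.mbounded_alt by blast
  have upper: "ereal (mdist Y y y') \<le> metric_diam Y" if "y \<in> mspace Y" "y' \<in> mspace Y" for y y'
    unfolding metric_diam_def using that by (intro SUP_upper2[of "(y, y')"]) auto
  have "metric_diam Y \<le> ereal C"
    unfolding metric_diam_def using C by (auto intro!: SUP_least)
  moreover obtain y where "y \<in> mspace Y" using assms(2) by auto
  then have "ereal 0 \<le> metric_diam Y" using upper[of y y] by simp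
  ultimately obtain m where m: "metric_diam Y = ereal m"
    by (cases "metric_diam Y") auto
  show thesis using that[OF m] upper m by simp
qed

text \<open>
  The walk. As \<open>g\<close> stays within \<open>E\<close> of \<open>f\<close>, a step on which \<open>f\<close> increases by more than \<open>E\<close> takes
  both functions beyond their previous values. This fixes the signs of the two crossed differences
  bounded below by \<open>cross\<close>; each step then gains \<open>2 \<kappa>\<close> over the triangle inequality.
\<close>

lemma crossed_gap_nonpos_right:
  fixes M :: "'a metric" and f g :: "'a \<Rightarrow> real"
  assumes a0: "a0 \<in> mspace M"
    and f: "\<And>a b. a \<in> mspace M \<Longrightarrow> b \<in> mspace M \<Longrightarrow> \<bar>f a - f b\<bar> \<le> mdist M a b + \<delta>"
    and g: "\<And>a b. a \<in> mspace M \<Longrightarrow> b \<in> mspace M \<Longrightarrow> \<bar>g a - g b\<bar> \<le> mdist M a b + \<delta>"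
    and near: "\<And>a. a \<in> mspace M \<Longrightarrow> \<bar>f a - g a\<bar> \<le> E"
    and cross: "\<And>a b. a \<in> mspace M \<Longrightarrow> b \<in> mspace M \<Longrightarrow> mdist M a b + \<kappa> \<le> \<bar>f a - g b\<bar>"
    and right: "\<And>C. \<exists>a\<in>mspace M. C < f a"
  shows "\<kappa> \<le> 0"
proof (rule ccontr)
  assume "\<not> \<kappa> \<le> 0"
  interpret M: Metric_space "mspace M" "mdist M" by simp
  have walk: "\<exists>a\<in>mspace M. 2 * mdist M a0 a + 2 * real n * \<kappa> \<le> (f a + g a) - (f a0 + g a0)" for n
  proof (induction n)
    case 0
    then show ?case using a0 by (intro bexI[of _ a0]) auto
  next
    case (Suc n)
    then obtain a where a: "a \<in> mspace M"
      and IH: "2 * mdist M a0 a + 2 * real n * \<kappa> \<le> (f a + g a) - (f a0 + g a0)" by blast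
    obtain b where b: "b \<in> mspace M" and step: "f a + E < f b" using right by blast
    have "mdist M a b + \<kappa> \<le> f b - g a"
      using cross[OF b a] near[OF a] step by (simp add: M.commute)
    moreover have "mdist M a b + \<kappa> \<le> g b - f a"
      using cross[OF a b] near[OF b] step by linarith
    moreover have "mdist M a0 b \<le> mdist M a0 a + mdist M a b"
      using M.triangle[OF a0 a b] .
    ultimately have "2 * mdist M a0 b + 2 * real (Suc n) * \<kappa> \<le> (f b + g b) - (f a0 + g a0)"
      using IH by (simp add: algebra_simps)
    then show ?case using b by blast
  qed
  have "real n * \<kappa> \<le> \<delta>" for n
  proof -
    obtain a where "a \<in> mspace M"
      and "2 * mdist M a0 a + 2 * real n * \<kappa> \<le> (f a + g a) - (f a0 + g a0)"
      using walk by blast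
    then show ?thesis using f[of a a0] g[of a a0] a0 by (simp add: M.commute)
  qed
  moreover obtain n where "\<delta> < real n * \<kappa>"
    using reals_Archimedean3[of \<kappa>] \<open>\<not> \<kappa> \<le> 0\<close> by auto
  ultimately show False by (meson not_le)
qed

text \<open>An unbounded \<open>f\<close> may also escape to the left only; then the walk is made for \<open>- f\<close> and \<open>- g\<close>.\<close>

lemma crossed_gap_nonpos:
  fixes M :: "'a metric" and f g :: "'a \<Rightarrow> real"
  assumes f: "\<And>a b. a \<in> mspace M \<Longrightarrow> b \<in> mspace M \<Longrightarrow> \<bar>f a - f b\<bar> \<le> mdist M a b + \<delta>"
    and g: "\<And>a b. a \<in> mspace M \<Longrightarrow> b \<in> mspace M \<Longrightarrow> \<bar>g a - g b\<bar> \<le> mdist M a b + \<delta>"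
    and near: "\<And>a. a \<in> mspace M \<Longrightarrow> \<bar>f a - g a\<bar> \<le> E"
    and cross: "\<And>a b. a \<in> mspace M \<Longrightarrow> b \<in> mspace M \<Longrightarrow> mdist M a b + \<kappa> \<le> \<bar>f a - g b\<bar>"
    and unbounded: "\<And>C. \<exists>a\<in>mspace M. \<exists>b\<in>mspace M. C < \<bar>f a - f b\<bar>"
  shows "\<kappa> \<le> 0"
proof -
  obtain a0 where a0: "a0 \<in> mspace M" using unbounded by blast
  show ?thesis
  proof (cases "\<forall>C. \<exists>a\<in>mspace M. C < f a")
    case True
    then show ?thesis using crossed_gap_nonpos_right[OF a0 f g near cross] by blast
  next
    case False
    then obtain U where U: "\<And>a. a \<in> mspace M \<Longrightarrow> f a \<le> U" by (meson not_le)
    have left: "\<exists>a\<in>mspace M. C < - f a" for C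
    proof -
      obtain a b where ab: "a \<in> mspace M" "b \<in> mspace M" "U + C < \<bar>f a - f b\<bar>"
        using unbounded by blast
      then have "C < - f a \<or> C < - f b" using U[of a] U[of b] by linarith
      then show ?thesis using ab by blast
    qed
    show ?thesis
    proof (rule crossed_gap_nonpos_right[OF a0, of "\<lambda>a. - f a" \<delta> "\<lambda>a. - g a" E])
      show "\<bar>- f a - - f b\<bar> \<le> mdist M a b + \<delta>" if "a \<in> mspace M" "b \<in> mspace M" for a b
        using f[OF that] by linarith
      show "\<bar>- g a - - g b\<bar> \<le> mdist M a b + \<delta>" if "a \<in> mspace M" "b \<in> mspace M" for a b
        using g[OF that] by linarith
      show "\<bar>- f a - - g a\<bar> \<le> E" if "a \<in> mspace M" for a
        using near[OF that] by linarith
      show "mdist M a b + \<kappa> \<le> \<bar>- f a - - g b\<bar>" if "a \<in> mspace M" "b \<in> mspace M" for a b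
        using cross[OF that] by linarith
    qed (rule left)
  qed
qed

text \<open>The walk, applied to the real coordinates of the images of the slices over \<open>x\<close> and \<open>x'\<close>.\<close>

lemma dist_le_of_almost_isometry_into_line_times_bounded:
  fixes M :: "'a metric" and X :: "'b metric" and Y :: "'c metric" and B :: "real set"
  assumes unbounded: "\<And>C. \<exists>a\<in>mspace M. \<exists>b\<in>mspace M. C < mdist M a b"
    and F: "F \<in> mspace (l1_prod M X) \<rightarrow> mspace (l1_prod (submetric euclidean_metric B) Y)"
    and dis: "\<And>p q. p \<in> mspace (l1_prod M X) \<Longrightarrow> q \<in> mspace (l1_prod M X) \<Longrightarrow>
      \<bar>mdist (l1_prod (submetric euclidean_metric B) Y) (F p) (F q) - mdist (l1_prod M X) p q\<bar> \<le> \<delta>"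
    and m: "\<And>y y'. y \<in> mspace Y \<Longrightarrow> y' \<in> mspace Y \<Longrightarrow> mdist Y y y' \<le> m"
    and x: "x \<in> mspace X" and x': "x' \<in> mspace X"
  shows "mdist X x x' \<le> \<delta> + m"
proof -
  interpret M: Metric_space "mspace M" "mdist M" by simp
  interpret X: Metric_space "mspace X" "mdist X" by simp
  interpret Y: Metric_space "mspace Y" "mdist Y" by simp
  define h where "h z a = fst (F (a, z))" for z a
  have upper: "\<bar>h z a - h w b\<bar> \<le> mdist M a b + mdist X z w + \<delta>"
    and lower: "mdist M a b + mdist X z w - \<delta> - m \<le> \<bar>h z a - h w b\<bar>"
    if "a \<in> mspace M" "b \<in> mspace M" "z \<in> mspace X" "w \<in> mspace X" for a b z w
  proof -
    obtain s y where s: "F (a, z) = (s, y)" by fastforce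
    obtain t y' where t: "F (b, w) = (t, y')" by fastforce
    have "F (a, z) \<in> B \<times> mspace Y" "F (b, w) \<in> B \<times> mspace Y" using F that by auto
    then have y: "y \<in> mspace Y" "y' \<in> mspace Y" using s t by auto
    have "\<bar>\<bar>s - t\<bar> + mdist Y y y' - (mdist M a b + mdist X z w)\<bar> \<le> \<delta>"
      using dis[of "(a, z)" "(b, w)"] that s t by (simp add: dist_real_def)
    then show "\<bar>h z a - h w b\<bar> \<le> mdist M a b + mdist X z w + \<delta>"
      and "mdist M a b + mdist X z w - \<delta> - m \<le> \<bar>h z a - h w b\<bar>"
      unfolding h_def s t fst_conv using m[OF y] Y.nonneg[of y y'] by linarith+
  qed
  have "mdist X x x' - \<delta> - m \<le> 0"
  proof (rule crossed_gap_nonpos[of M "h x" \<delta> "h x'" "mdist X x x' + \<delta>"])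
    show "\<exists>a\<in>mspace M. \<exists>b\<in>mspace M. C < \<bar>h x a - h x b\<bar>" for C
    proof -
      obtain a b where ab: "a \<in> mspace M" "b \<in> mspace M" "C + \<delta> + m < mdist M a b"
        using unbounded by blast
      then have "C < \<bar>h x a - h x b\<bar>" using lower[of a b x x] x by simp
      then show ?thesis using ab by blast
    qed
  next
    fix a b assume ab: "a \<in> mspace M" "b \<in> mspace M"
    show "\<bar>h x a - h x b\<bar> \<le> mdist M a b + \<delta>" using upper[OF ab x x] x by simp
    show "\<bar>h x' a - h x' b\<bar> \<le> mdist M a b + \<delta>" using upper[OF ab x' x'] x' by simp
    show "mdist M a b + (mdist X x x' - \<delta> - m) \<le> \<bar>h x a - h x' b\<bar>"
      using lower[OF ab x x'] by simp
  next
    fix a assume a: "a \<in> mspace M"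
    show "\<bar>h x a - h x' a\<bar> \<le> mdist X x x' + \<delta>" using upper[OF a a x x'] a by simp
  qed
  then show ?thesis by simp
qed

lemma finite_gh_dist_unbounded:
  fixes A :: "'b::euclidean_space set" and A' :: "'a metric"
  assumes "\<not> bounded A" and "gh_dist (submetric euclidean_metric A) A' < \<infinity>"
  shows "\<exists>a\<in>mspace A'. \<exists>b\<in>mspace A'. C < mdist A' a b"
proof -
  obtain r where "gh_dist (submetric euclidean_metric A) A' < ereal r"
    using assms(2) ereal_dense2 by blast
  then obtain F where F: "F \<in> mspace (submetric euclidean_metric A) \<rightarrow> mspace A'"
    and dis: "\<And>p q. p \<in> mspace (submetric euclidean_metric A) \<Longrightarrow>
      q \<in> mspace (submetric euclidean_metric A) \<Longrightarrow>
      \<bar>mdist A' (F p) (F q) - mdist (submetric euclidean_metric A) p q\<bar> \<le> 2 * r"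
    by (rule gh_dist_less_imp_map) blast
  obtain p q where pq: "p \<in> A" "q \<in> A" and "C + 2 * r < dist p q"
    using assms(1) unfolding bounded_two_points by (meson not_le)
  then have "C < mdist A' (F p) (F q)" using dis[of p q] by simp
  then show ?thesis using F pq by auto
qed

theorem theorem4:
  fixes A B :: "real set"
    and A' :: "'a metric" and X :: "'b metric" and Y :: "'c metric"
  assumes "\<not> bounded A"
    and "mspace A' \<noteq> {}"
    and "gh_dist (submetric euclidean_metric A) A' < \<infinity>"
    and "B \<noteq> {}"
    and "mspace X \<noteq> {}" and "bounded_metric X"
    and "mspace Y \<noteq> {}" and "bounded_metric Y"
  shows "gh_dist (l1_prod A' X) (l1_prod (submetric euclidean_metric B) Y)
           \<ge> (metric_diam X - metric_diam Y) / 2"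
proof (rule ccontr)
  obtain k where k: "metric_diam X = ereal k"
    using bounded_metric_diam[OF assms(6,5)] by blast
  obtain m where m: "metric_diam Y = ereal m"
    and Ym: "\<And>y y'. y \<in> mspace Y \<Longrightarrow> y' \<in> mspace Y \<Longrightarrow> mdist Y y y' \<le> m"
    using bounded_metric_diam[OF assms(8,7)] by blast
  assume "\<not> ?thesis"
  then have "gh_dist (l1_prod A' X) (l1_prod (submetric euclidean_metric B) Y) < ereal ((k - m) / 2)"
    by (simp add: k m)
  then obtain r where r: "gh_dist (l1_prod A' X) (l1_prod (submetric euclidean_metric B) Y) < ereal r"
    and "r < (k - m) / 2"
    using ereal_dense2 by fastforce
  obtain F where "F \<in> mspace (l1_prod A' X) \<rightarrow> mspace (l1_prod (submetric euclidean_metric B) Y)"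
    and "\<And>p q. p \<in> mspace (l1_prod A' X) \<Longrightarrow> q \<in> mspace (l1_prod A' X) \<Longrightarrow>
      \<bar>mdist (l1_prod (submetric euclidean_metric B) Y) (F p) (F q) - mdist (l1_prod A' X) p q\<bar> \<le> 2 * r"
    using gh_dist_less_imp_map[OF r] by blast
  note * = dist_le_of_almost_isometry_into_line_times_bounded
    [OF finite_gh_dist_unbounded[OF assms(1,3)] this Ym]
  have "metric_diam X \<le> ereal (2 * r + m)"
    unfolding metric_diam_def using * by (auto intro!: SUP_least)
  then show False using k \<open>r < (k - m) / 2\<close> by simp
qed

end
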